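(* Fix $d\ge3$ and put $$c_d=\frac{d-1}{32d^2},\qquad C_d=8d(d+1).$$ Uniformly for every $0<\tau\le1$, every odd prime power $q\ge C_d/\tau$, and every $\gamma\in\mathbb F_q$, the root-evaluation system $\mathcal D_{d,\gamma}$ admits no $(\tau,\varepsilon)$-centered block decomposition with $\varepsilon\le c_d\tau^2$. In particular, this conclusion holds for the rational-normal-curve sphere system $(P_{\mathrm{rn}},\mathcal S_{\mathrm{rn}})$ described in the context. More quantitatively, writing $P$ and $\mathcal S$ for the two sides (points and objects) of $\mathcal D_{d,\gamma}$ and $\Sigma=\sigma(P,\mathcal S)$, every integer $m\ge2$ and all matched partitions $\mathcal S=\mathcal S_1\sqcup\cdots\sqcup\mathcal S_m$, $P=A_1\sqcup\cdots\sqcup A_m\sqcup R$ satisfying $$\sigma(A_i,\mathcal S_i)\ge\tau\Sigma\ (1\le i\le m)\qquad\text{and}\qquad\sigma(R,\mathcal S)\le c_d\tau^2\Sigma$$ obey $$\sum_{i\ne j}\sigma(A_i,\mathcal S_j)_+\ge2c_d\tau^2\Sigma.$$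
   Context: Root-evaluation system: for $d\ge3$, $\gamma\in\mathbb F_q$, $\mathcal D_{d,\gamma}$ is the bipartite incidence system with object set $\mathbb F_q$, point set $$\mathfrak A_{d,\gamma}=\Bigl\{A\subseteq\mathbb F_q:|A|=d,\ -\sum_{a\in A}a\ne\gamma\Bigr\},$$ and $A$ incident to $t$ exactly when $t\in A$. For a set $B$ of points and a set $\mathcal T$ of objects (or spheres), $\sigma(B,\mathcal T)=I(B,\mathcal T)-|B||\mathcal T|/q$, where $I$ counts incident pairs. Put $x_+=\max\{x,0\}$. Let $\Sigma=\sigma(P,\mathcal S)>0$, $0<\tau\le1$, $\varepsilon\ge0$. A $(\tau,\varepsilon)$-centered block decomposition consists of an integer $m\ge2$ and partitions $\mathcal S=\mathcal S_1\sqcup\cdots\sqcup\mathcal S_m$, $P=A_1\sqcup\cdots\sqcup A_m\sqcup R$ such that $\sigma(A_i,\mathcal S_i)\ge\tau\Sigma$ for $1\le i\le m$, $\sigma(R,\mathcal S)\le\varepsilon\Sigma$, and $\sum_{i\ne j}\sigma(A_i,\mathcal S_j)_+\le\varepsilon\Sigma$. Rational-normal-curve sphere system: let $Q$ be a nondegenerate quadratic form on $\mathbb F_q^d$, $\langle x,y\rangle_Q=\frac{Q(x+y)-Q(x)-Q(y)}2$, $S_Q(c,r)=\{x:Q(x-c)=r\}$. Use a Witt decomposition $\mathbb F_q^d=\mathbb F_qe\oplus\mathbb F_qf\oplus V_0$ with $Q(xe+yf+z)=xy+Q_\perp(z)$, $Q_\perp$ nondegenerate, and a basis $u_1,\dots,u_{d-2}$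 of $V_0$. Put $z_t=\sum_{j=1}^{d-2}t^ju_j$, $c_t=t^{d-1}f+z_t$, $\gamma=-1-Q(c_1)$, $g(t)=Q(c_t)+t^d+\gamma t^{d-1}$; choose $\kappa$ with $-\kappa\notin g(\mathbb F_q)$ (possible since $g(0)=g(1)$); put $r_t=Q(c_t)+t^d+\gamma t^{d-1}+\kappa$, $S_t=S_Q(c_t,r_t)$, $\mathcal S_{\mathrm{rn}}=\{S_t:t\in\mathbb F_q\}$. The map $\Psi(xe+yf+z)(T)=T^d+(x+\gamma)T^{d-1}+\sum_{j=1}^{d-2}2\langle z,u_j\rangle_QT^j+\kappa-Q(xe+yf+z)$ is a bijection from $\{xe+yf+z:x\ne0\}$ onto the monic degree-$d$ polynomials with $T^{d-1}$-coefficient $\ne\gamma$; $p_A$ is the point with $\Psi(p_A)=\prod_{a\in A}(T-a)$, and $P_{\mathrm{rn}}=\{p_A:A\in\mathfrak A_{d,\gamma}\}$. With this $\gamma$, $(P_{\mathrm{rn}},\mathcal S_{\mathrm{rn}})$ is incidence-isomorphic to $\mathcal D_{d,\gamma}$ via $p_A\leftrightarrow A$, $S_t\leftrightarrow t$. *)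

theory Defs
  imports "HOL-Analysis.Analysis" "HOL-Computational_Algebra.Polynomial"
begin

section \<open>Discrepancy and centered block decompositions\<close>

definition incidences :: "('p \<Rightarrow> 's \<Rightarrow> bool) \<Rightarrow> 'p set \<Rightarrow> 's set \<Rightarrow> nat" where
  "incidences inc B T = card {(p, s). p \<in> B \<and> s \<in> T \<and> inc p s}"

definition discrep :: "nat \<Rightarrow> ('p \<Rightarrow> 's \<Rightarrow> bool) \<Rightarrow> 'p set \<Rightarrow> 's set \<Rightarrow> real" where
  "discrep q inc B T = real (incidences inc B T) - real (card B) * real (card T) / real q"

text \<open>
  Blocks are indexed by \<open>{1..m}\<close>. Empty parts are not excluded here: a block with
  \<open>discrep q inc (A i) (SS i) > 0\<close> is nonempty on both sides anyway, and the remainder \<open>R\<close>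
  may be empty.
\<close>

definition matched_partitions ::
  "'p set \<Rightarrow> 's set \<Rightarrow> nat \<Rightarrow> (nat \<Rightarrow> 'p set) \<Rightarrow> (nat \<Rightarrow> 's set) \<Rightarrow> 'p set \<Rightarrow> bool" where
  "matched_partitions P S m A SS R \<longleftrightarrow>
     disjoint_family_on SS {1..m} \<and> (\<Union>i\<in>{1..m}. SS i) = S \<and>
     disjoint_family_on A {1..m} \<and> (\<Union>i\<in>{1..m}. A i) \<inter> R = {} \<and> (\<Union>i\<in>{1..m}. A i) \<union> R = P"

definition cross_discrep ::
  "nat \<Rightarrow> ('p \<Rightarrow> 's \<Rightarrow> bool) \<Rightarrow> nat \<Rightarrow> (nat \<Rightarrow> 'p set) \<Rightarrow> (nat \<Rightarrow> 's set) \<Rightarrow> real" where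
  "cross_discrep q inc m A SS =
     (\<Sum>(i, j) \<in> {(i, j). i \<in> {1..m} \<and> j \<in> {1..m} \<and> i \<noteq> j}. max (discrep q inc (A i) (SS j)) 0)"

text \<open>
  The notion is meant for \<open>discrep q inc P S > 0\<close>, \<open>0 < \<tau> \<le> 1\<close> and \<open>\<epsilon> \<ge> 0\<close>. These standing
  assumptions are deliberately not conjuncts of the definition, so that the absence of a
  decomposition can never hold merely because one of them fails.
\<close>

definition has_centered_block_decomposition ::
  "nat \<Rightarrow> ('p \<Rightarrow> 's \<Rightarrow> bool) \<Rightarrow> 'p set \<Rightarrow> 's set \<Rightarrow> real \<Rightarrow> real \<Rightarrow> bool" where
  "has_centered_block_decomposition q inc P S \<tau> \<epsilon> \<longleftrightarrow>
     (\<exists>m A SS R. m \<ge> 2 \<and> matched_partitions P S m A SS R \<and>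
        (\<forall>i\<in>{1..m}. discrep q inc (A i) (SS i) \<ge> \<tau> * discrep q inc P S) \<and>
        discrep q inc R S \<le> \<epsilon> * discrep q inc P S \<and>
        cross_discrep q inc m A SS \<le> \<epsilon> * discrep q inc P S)"

section \<open>The root-evaluation system\<close>

text \<open>The objects are all field elements, i.e. \<open>UNIV :: 'a set\<close>.\<close>

definition root_points :: "nat \<Rightarrow> 'a::field \<Rightarrow> 'a set set" where
  "root_points d \<gamma> = {A. finite A \<and> card A = d \<and> - (\<Sum>a\<in>A. a) \<noteq> \<gamma>}"

definition root_inc :: "'a set \<Rightarrow> 'a \<Rightarrow> bool" where
  "root_inc A t \<longleftrightarrow> t \<in> A"

section \<open>Quadratic forms\<close>

definition qinner :: "('a::field ^ 'n \<Rightarrow> 'a) \<Rightarrow> 'a ^ 'n \<Rightarrow> 'a ^ 'n \<Rightarrow> 'a" where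
  "qinner Q x y = (Q (x + y) - Q x - Q y) / 2"

text \<open>Only used in odd characteristic. Linearity in one argument suffices by symmetry.\<close>

definition quadratic_form :: "('a::field ^ 'n \<Rightarrow> 'a) \<Rightarrow> bool" where
  "quadratic_form Q \<longleftrightarrow>
     (\<forall>a x. Q (a *s x) = a\<^sup>2 * Q x) \<and> (\<forall>x. Vector_Spaces.linear (*s) (*) (qinner Q x))"

definition nondegenerate_on :: "('a::field ^ 'n) set \<Rightarrow> ('a ^ 'n \<Rightarrow> 'a) \<Rightarrow> bool" where
  "nondegenerate_on W Q \<longleftrightarrow> (\<forall>x\<in>W. (\<forall>y\<in>W. qinner Q x y = 0) \<longrightarrow> x = 0)"

definition qsphere :: "('a::field ^ 'n \<Rightarrow> 'a) \<Rightarrow> 'a ^ 'n \<Rightarrow> 'a \<Rightarrow> ('a ^ 'n) set" where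
  "qsphere Q c r = {x. Q (x - c) = r}"

text \<open>
  The form on the complement \<open>V0\<close> is necessarily the restriction of \<open>Q\<close> (take \<open>x = y = 0\<close>),
  so it is not a separate parameter.
\<close>

definition witt_decomposition ::
  "('a::field ^ 'n \<Rightarrow> 'a) \<Rightarrow> 'a ^ 'n \<Rightarrow> 'a ^ 'n \<Rightarrow> ('a ^ 'n) set \<Rightarrow> bool" where
  "witt_decomposition Q e f V0 \<longleftrightarrow>
     vec.subspace V0 \<and>
     (\<forall>v. \<exists>!(x, y, z). z \<in> V0 \<and> v = x *s e + y *s f + z) \<and>
     (\<forall>x y. \<forall>z\<in>V0. Q (x *s e + y *s f + z) = x * y + Q z) \<and>
     nondegenerate_on V0 Q"

section \<open>The rational-normal-curve sphere system\<close>

locale rational_normal_system =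
  fixes d :: nat
    and Q :: "'a::{field,finite} ^ 'n \<Rightarrow> 'a"
    and e f :: "'a ^ 'n"
    and V0 :: "('a ^ 'n) set"
    and u :: "nat \<Rightarrow> 'a ^ 'n"
    and \<kappa> :: 'a
begin

definition center :: "'a \<Rightarrow> 'a ^ 'n" where
  "center t = t ^ (d - 1) *s f + (\<Sum>j=1..d - 2. t ^ j *s u j)"

definition gam :: 'a where
  "gam = - 1 - Q (center 1)"

definition g :: "'a \<Rightarrow> 'a" where
  "g t = Q (center t) + t ^ d + gam * t ^ (d - 1)"

definition radius :: "'a \<Rightarrow> 'a" where
  "radius t = Q (center t) + t ^ d + gam * t ^ (d - 1) + \<kappa>"

definition spheres :: "('a ^ 'n) set set" where
  "spheres = {qsphere Q (center t) (radius t) | t. t \<in> UNIV}"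

text \<open>The map \<open>\<Psi>\<close>, as a function of the coordinates of the point \<open>x *s e + y *s f + z\<close>.\<close>

definition Psi :: "'a \<Rightarrow> 'a \<Rightarrow> 'a ^ 'n \<Rightarrow> 'a poly" where
  "Psi x y z =
     monom 1 d + monom (x + gam) (d - 1)
     + (\<Sum>j=1..d - 2. monom (2 * qinner Q z (u j)) j)
     + [:\<kappa> - Q (x *s e + y *s f + z):]"

definition root_point :: "'a set \<Rightarrow> 'a ^ 'n" where
  "root_point A =
     (THE p. \<exists>x y z. x \<noteq> 0 \<and> z \<in> V0 \<and> p = x *s e + y *s f + z \<and>
                     Psi x y z = (\<Prod>a\<in>A. [:- a, 1:]))"

definition points :: "('a ^ 'n) set" where
  "points = root_point ` root_points d gam"

definition admissible :: bool where
  "admissible \<longleftrightarrow>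
     CARD('n) = d \<and>
     quadratic_form Q \<and> nondegenerate_on UNIV Q \<and>
     witt_decomposition Q e f V0 \<and>
     inj_on u {1..d - 2} \<and> vec.independent (u ` {1..d - 2}) \<and> vec.span (u ` {1..d - 2}) = V0 \<and>
     - \<kappa> \<notin> range g"

end

section \<open>The constants\<close>

definition c_const :: "nat \<Rightarrow> real" where
  "c_const d = (real d - 1) / (32 * (real d)\<^sup>2)"

definition C_const :: "nat \<Rightarrow> real" where
  "C_const d = 8 * real d * (real d + 1)"

end

theory Submission
  imports Defs
begin

text \<open>
  Moving a point \<open>A\<close> into block \<open>i\<close> leaves the off-diagonal discrepancy
  \<open>d - 1 - card (A \<inter> S i) + card (S i) / q\<close>, which is negative only if \<open>A \<subseteq> S i\<close>. Sets inside a
  block are outweighed by the sets with exactly one element outside that block, because both kinds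
  extend the same \<open>(d - 1)\<close>-subsets and there are enough elements outside. Since each block carries
  discrepancy at least \<open>\<tau> * \<Sigma>\<close>, it and its complement contain a proportion of order \<open>\<tau>\<close> of the
  field, which makes the total cost linear in \<open>\<tau>\<close>, more than the remainder \<open>R\<close> can absorb.
  A sphere \<open>S\<^sub>t\<close> contains \<open>p\<close> iff \<open>t\<close> is a root of \<open>\<Psi>(p)\<close>, which transfers the result to the
  sphere system.
\<close>

section \<open>Discrepancies as double sums\<close>

text \<open>A sum of the centered kernel \<open>of_bool (inc p t) - 1 / q\<close> makes additivity
  over disjoint sets of points or objects visible.\<close>

lemma discrep_eq_sum:
  assumes "finite B" "finite T"
  shows "discrep q inc B T = (\<Sum>p\<in>B. \<Sum>t\<in>T. of_bool (inc p t) - 1 / real q)"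
proof -
  have "{(p, s). p \<in> B \<and> s \<in> T \<and> inc p s} = (SIGMA p:B. {s \<in> T. inc p s})"
    by auto
  hence "real (incidences inc B T) = (\<Sum>p\<in>B. real (card {s \<in> T. inc p s}))"
    using assms by (simp add: incidences_def)
  also have "\<dots> = (\<Sum>p\<in>B. \<Sum>t\<in>T. of_bool (inc p t))"
    using assms by (simp add: of_bool_def sum.If_cases Int_def)
  finally show ?thesis
    by (simp add: discrep_def sum_subtractf)
qed

lemma discrep_UN_right:
  assumes "finite B" "finite J" "\<And>j. j \<in> J \<Longrightarrow> finite (T j)" "disjoint_family_on T J"
  shows "discrep q inc B (\<Union>j\<in>J. T j) = (\<Sum>j\<in>J. discrep q inc B (T j))"
proof -
  have "discrep q inc B (\<Union>j\<in>J. T j)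
      = (\<Sum>p\<in>B. \<Sum>j\<in>J. \<Sum>t\<in>T j. of_bool (inc p t) - 1 / real q)"
    using assms by (subst discrep_eq_sum)
      (auto simp: disjoint_family_on_def intro!: sum.cong sum.UNION_disjoint)
  also have "\<dots> = (\<Sum>j\<in>J. discrep q inc B (T j))"
    using assms by (subst sum.swap) (simp add: discrep_eq_sum)
  finally show ?thesis .
qed

lemma discrep_root_inc:
  fixes T :: "'a::finite set"
  assumes "finite B"
  shows "discrep q root_inc B T = (\<Sum>A\<in>B. real (card (A \<inter> T)) - real (card T) / real q)"
proof -
  have "(\<Sum>t\<in>T. of_bool (t \<in> A) :: real) = real (card (A \<inter> T))" for A
    by (simp add: of_bool_def sum.If_cases Int_commute)
  thus ?thesis
    by (simp add: discrep_eq_sum assms root_inc_def sum_subtractf)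
qed

text \<open>Each point meets the whole field in \<open>d\<close> elements, and the whole field has
  relative size 1. Hence the total discrepancy and that of the remainder are cardinalities up to the
  factor \<open>d - 1\<close>.\<close>

lemma discrep_root_points_UNIV:
  assumes "B \<subseteq> root_points d (\<gamma>::'a::{field,finite})"
  shows "discrep CARD('a) root_inc B UNIV = (real d - 1) * real (card B)"
proof -
  have "discrep CARD('a) root_inc B UNIV = (\<Sum>A\<in>B. real d - 1)"
    using assms unfolding discrep_root_inc[OF finite] by (intro sum.cong) (auto simp: root_points_def)
  thus ?thesis by simp
qed

text \<open>By additivity, the off-diagonal entries of row \<open>i\<close> sum to the full
  discrepancy of \<open>A i\<close> minus the diagonal entry; taking positive parts only increases
  them.\<close>

lemma cross_discrep_ge:
  fixes A :: "nat \<Rightarrow> 'p::finite set" and SS :: "nat \<Rightarrow> 's::finite set"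
  assumes "disjoint_family_on SS {1..m}"
  shows "(\<Sum>i\<in>{1..m}. discrep q inc (A i) (\<Union>j\<in>{1..m}. SS j) - discrep q inc (A i) (SS i))
         \<le> cross_discrep q inc m A SS"
proof -
  have eq: "{(i, j). i \<in> {1..m} \<and> j \<in> {1..m} \<and> i \<noteq> j} = (SIGMA i:{1..m}. {1..m} - {i})"
    by auto
  have "(\<Sum>i\<in>{1..m}. discrep q inc (A i) (\<Union>j\<in>{1..m}. SS j) - discrep q inc (A i) (SS i))
      = (\<Sum>i\<in>{1..m}. \<Sum>j\<in>{1..m} - {i}. discrep q inc (A i) (SS j))"
    using assms by (intro sum.cong) (simp_all add: discrep_UN_right sum_diff1)
  also have "\<dots> \<le> (\<Sum>i\<in>{1..m}. \<Sum>j\<in>{1..m} - {i}. max (discrep q inc (A i) (SS j)) 0)"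
    by (intro sum_mono) auto
  also have "\<dots> = cross_discrep q inc m A SS"
    unfolding cross_discrep_def eq by (subst sum.Sigma) auto
  finally show ?thesis .
qed

section \<open>Counting sets with few elements outside a block\<close>

text \<open>Deleting \<open>t\<close> is injective on the sets containing \<open>t\<close>. Together
  with \<open>card_root_points_ge\<close> this bounds the share of points incident to one
  object.\<close>

lemma card_root_points_containing_le:
  fixes \<gamma> :: "'a::{field,finite}"
  shows "card {A \<in> root_points d \<gamma>. t \<in> A} \<le> card {B :: 'a set. card B = d - 1}"
proof (rule card_inj_on_le)
  show "inj_on (\<lambda>A. A - {t}) {A \<in> root_points d \<gamma>. t \<in> A}"
    by (rule inj_onI) (metis (mono_tags, lifting) insert_Diff mem_Collect_eq)
qed (auto simp: root_points_def)

text \<open>A \<open>(d - 1)\<close>-set has exactly one extension with the forbidden sum, hence the loss of one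
  in the next two counts.\<close>

lemma card_extensions_ge:
  fixes \<gamma> :: "'a::{field,finite}"
  assumes "d \<ge> 1" "card B = d - 1" "B \<subseteq> U"
  shows "real CARD('a) - real (card U) - 1 \<le> real (card {u. u \<notin> U \<and> insert u B \<in> root_points d \<gamma>})"
proof -
  have "- U - {- \<gamma> - \<Sum>B} \<subseteq> {u. u \<notin> U \<and> insert u B \<in> root_points d \<gamma>}"
  proof
    fix u assume u: "u \<in> - U - {- \<gamma> - \<Sum>B}"
    hence "u \<notin> B" using assms by auto
    moreover have "- (u + \<Sum>B) \<noteq> \<gamma>"
    proof
      assume "- (u + \<Sum>B) = \<gamma>"
      hence "u = - \<gamma> - \<Sum>B" by auto
      thus False using u by simp
    qed
    ultimately show "u \<in> {u. u \<notin> U \<and> insert u B \<in> root_points d \<gamma>}"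
      using u assms by (simp add: root_points_def)
  qed
  hence "card (- U - {- \<gamma> - \<Sum>B}) \<le> card {u. u \<notin> U \<and> insert u B \<in> root_points d \<gamma>}"
    by (intro card_mono) auto
  moreover have "card (- U) - 1 \<le> card (- U - {- \<gamma> - \<Sum>B})"
    using diff_card_le_card_Diff[of "{- \<gamma> - \<Sum>B}" "- U"] by simp
  moreover have "card (- U) = CARD('a) - card U"
    by (simp add: Compl_eq_Diff_UNIV card_Diff_subset)
  moreover have "card U \<le> CARD('a)"
    by (rule card_mono) auto
  ultimately show ?thesis by linarith
qed

text \<open>Double counting of pairs of an admissible set and one of its elements: deleting the
  element leaves a \<open>(d - 1)\<close>-set, and each of those has at least
  \<open>q - (d - 1) - 1\<close> admissible extensions.\<close>

lemma card_root_points_ge: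
  fixes \<gamma> :: "'a::{field,finite}"
  assumes "d \<ge> 1"
  shows "(real CARD('a) - real d) * real (card {B :: 'a set. card B = d - 1})
         \<le> real d * real (card (root_points d \<gamma>))"
proof -
  let ?E = "\<lambda>B. {u. u \<notin> B \<and> insert u B \<in> root_points d \<gamma>}"
  let ?X = "SIGMA B:{B :: 'a set. card B = d - 1}. ?E B"
  have "(real CARD('a) - real d) * real (card {B :: 'a set. card B = d - 1})
      = (\<Sum>B\<in>{B :: 'a set. card B = d - 1}. real CARD('a) - real d)" by simp
  also have "\<dots> \<le> (\<Sum>B\<in>{B :: 'a set. card B = d - 1}. real (card (?E B)))"
    using assms card_extensions_ge[of d _ _ \<gamma>] by (intro sum_mono) (force simp: of_nat_diff)
  also have "\<dots> = real (card ?X)" by simp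
  also have "card ?X \<le> card (SIGMA A:root_points d \<gamma>. A)"
  proof (rule card_inj_on_le)
    show "inj_on (\<lambda>(B, u). (insert u B, u)) ?X"
      by (rule inj_onI) (auto simp: insert_ident)
  qed auto
  also have "card (SIGMA A:root_points d \<gamma>. A) = d * card (root_points d \<gamma>)"
    by (simp add: root_points_def)
  finally show ?thesis by simp
qed

text \<open>Both sides are compared with the number of \<open>(d - 1)\<close>-subsets of \<open>T\<close>.\<close>

lemma card_inside_le_card_almost_inside:
  fixes \<gamma> :: "'a::{field,finite}"
  assumes "d \<ge> 1"
  shows "real d * real (card {A \<in> root_points d \<gamma>. card (A \<inter> T) = d})
           * (real CARD('a) - real (card T) - 1)
         \<le> real (card T) * real (card {A \<in> root_points d \<gamma>. card (A \<inter> T) = d - 1})"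
    (is "real d * real (card ?I) * ?x \<le> real (card T) * real (card ?J)")
proof (cases "?x \<ge> 0")
  case False
  hence "real d * real (card ?I) * ?x \<le> 0"
    by (intro mult_nonneg_nonpos) auto
  also have "0 \<le> real (card T) * real (card ?J)" by simp
  finally show ?thesis .
next
  case True
  let ?B = "{B. B \<subseteq> T \<and> card B = d - 1}"
  let ?E = "\<lambda>B. {u. u \<notin> T \<and> insert u B \<in> root_points d \<gamma>}"
  have sub: "A \<subseteq> T" "card A = d" if "A \<in> ?I" for A
  proof -
    show c: "card A = d" using that by (simp add: root_points_def)
    have "A \<inter> T = A" using that c by (intro card_subset_eq) auto
    thus "A \<subseteq> T" by auto
  qed
  \<comment> \<open>Deleting a chosen element of an inside set leaves a
    \<open>(d - 1)\<close>-subset of \<open>T\<close>; the pair of both recovers the set.\<close>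
  have "card (SIGMA A:?I. A) \<le> card (?B \<times> T)"
  proof (rule card_inj_on_le)
    show "inj_on (\<lambda>(A, t). (A - {t}, t)) (SIGMA A:?I. A)"
      by (rule inj_on_inverseI[where g = "\<lambda>(B, t). (insert t B, t)"]) (auto simp: insert_absorb)
    show "(\<lambda>(A, t). (A - {t}, t)) ` (SIGMA A:?I. A) \<subseteq> ?B \<times> T"
    proof (rule image_subsetI)
      fix x assume "x \<in> (SIGMA A:?I. A)"
      then obtain A t where x: "x = (A, t)" "A \<in> ?I" "t \<in> A" by blast
      from sub[OF x(2)] x show "(case x of (A, t) \<Rightarrow> (A - {t}, t)) \<in> ?B \<times> T" by auto
    qed
  qed auto
  moreover have "card (SIGMA A:?I. A) = d * card ?I"
    by (subst card_SigmaI) (auto simp: root_points_def)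
  ultimately have 1: "real d * real (card ?I) \<le> real (card ?B) * real (card T)"
    by (simp flip: of_nat_mult)
  \<comment> \<open>Conversely, each \<open>(d - 1)\<close>-subset \<open>B\<close> of
    \<open>T\<close> has at least \<open>?x\<close> admissible extensions by an element outside
    \<open>T\<close>, and \<open>B\<close> is recovered as the intersection with
    \<open>T\<close>.\<close>
  have "real (card ?B) * ?x = (\<Sum>B\<in>?B. ?x)" by simp
  also have "\<dots> \<le> (\<Sum>B\<in>?B. real (card (?E B)))"
    using assms by (intro sum_mono card_extensions_ge) auto
  also have "\<dots> = real (card (SIGMA B:?B. ?E B))" by simp
  also have "card (SIGMA B:?B. ?E B) \<le> card ?J"
  proof (rule card_inj_on_le)
    have eq: "insert u B \<inter> T = B" "insert u B - T = {u}" if "B \<subseteq> T" "u \<notin> T" for u B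
      using that by auto
    show "inj_on (\<lambda>(B, u). insert u B) (SIGMA B:?B. ?E B)"
      by (rule inj_on_inverseI[where g = "\<lambda>A. (A \<inter> T, the_elem (A - T))"]) (auto simp: eq)
    show "(\<lambda>(B, u). insert u B) ` (SIGMA B:?B. ?E B) \<subseteq> ?J"
      by (auto simp: eq Int_absorb2)
  qed auto
  finally have 2: "real (card ?B) * ?x \<le> real (card ?J)" by simp
  have "real d * real (card ?I) * ?x \<le> real (card ?B) * real (card T) * ?x"
    using 1 True by (intro mult_right_mono)
  also have "\<dots> = real (card T) * (real (card ?B) * ?x)" by simp
  also have "\<dots> \<le> real (card T) * real (card ?J)"
    using 2 by (intro mult_left_mono) auto
  finally show ?thesis .
qed


text \<open>The discrepancy is at most the number of incidences, and one object lies in at most as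
  many points as there are \<open>(d - 1)\<close>-sets, which is at most a fraction
  \<open>2 * d / q\<close> of all points.\<close>

lemma card_block_ge:
  fixes \<gamma> :: "'a::{field,finite}"
  assumes "d \<ge> 1" "2 * real d < real CARD('a)" "B \<subseteq> root_points d \<gamma>"
    and "\<tau> * ((real d - 1) * real (card (root_points d \<gamma>))) \<le> discrep CARD('a) root_inc B T"
  shows "\<tau> * (real d - 1) / (2 * real d) \<le> real (card T) / real CARD('a)"
proof -
  let ?P = "root_points d \<gamma>" and ?q = "real CARD('a)"
  let ?\<beta> = "real (card {B :: 'a set. card B = d - 1})"
  have "\<exists>B :: 'a set. card B = d - 1"
  proof -
    have "d - 1 \<le> CARD('a)" using assms(2) by linarith
    thus ?thesis using obtain_subset_with_card_n by metis
  qed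
  hence "0 < ?\<beta>" by (simp add: card_gt_0_iff)
  hence "0 < (?q - real d) * ?\<beta>" using assms(2) by (intro mult_pos_pos) auto
  hence "0 < real d * real (card ?P)"
    using card_root_points_ge[OF assms(1), of \<gamma>] by linarith
  hence P: "0 < real (card ?P)" by (simp add: zero_less_mult_iff)
  \<comment> \<open>\<open>2 * d < q\<close> gives \<open>?q \<le> 2 * (?q - real d)\<close>, the
    source of the factor 2 in the bound.\<close>
  have "?q * ?\<beta> \<le> (2 * (?q - real d)) * ?\<beta>"
    using assms(2) by (intro mult_right_mono) auto
  also have "\<dots> = 2 * ((?q - real d) * ?\<beta>)" by simp
  also have "\<dots> \<le> 2 * (real d * real (card ?P))"
    using card_root_points_ge[OF assms(1), of \<gamma>] by simp
  finally have \<beta>: "?q * ?\<beta> \<le> 2 * (real d * real (card ?P))" .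
  have "\<tau> * ((real d - 1) * real (card ?P)) \<le> (\<Sum>A\<in>B. real (card (A \<inter> T)))"
    using assms(4) unfolding discrep_root_inc[OF finite]
    by (rule order_trans) (intro sum_mono, simp)
  also have "\<dots> \<le> (\<Sum>A\<in>?P. real (card (A \<inter> T)))"
    using assms(3) by (intro sum_mono2) auto
  also have "\<dots> = (\<Sum>A\<in>?P. \<Sum>t\<in>T. of_bool (t \<in> A))"
    by (simp add: of_bool_def sum.If_cases Int_commute)
  also have "\<dots> = (\<Sum>t\<in>T. real (card {A \<in> ?P. t \<in> A}))"
    by (subst sum.swap) (simp add: of_bool_def sum.If_cases Int_def)
  also have "\<dots> \<le> (\<Sum>t\<in>T. ?\<beta>)"
    using card_root_points_containing_le by (intro sum_mono) auto
  finally have "\<tau> * ((real d - 1) * real (card ?P)) \<le> real (card T) * ?\<beta>" by simp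
  hence "\<tau> * ((real d - 1) * real (card ?P)) * ?q \<le> real (card T) * ?\<beta> * ?q"
    by (intro mult_right_mono) auto
  also have "\<dots> = real (card T) * (?q * ?\<beta>)" by simp
  also have "\<dots> \<le> real (card T) * (2 * (real d * real (card ?P)))"
    using \<beta> by (intro mult_left_mono) auto
  finally have "(\<tau> * (real d - 1) * ?q) * real (card ?P) \<le> (real (card T) * (2 * real d)) * real (card ?P)"
    by (simp add: mult_ac)
  hence "\<tau> * (real d - 1) * ?q \<le> real (card T) * (2 * real d)"
    using P by (simp only: mult_le_cancel_right_pos)
  thus ?thesis using assms(1) by (simp add: field_simps)
qed

section \<open>A lower bound for the cost of a matching\<close>

text \<open>
  A point \<open>A\<close> put into block \<open>i\<close> contributes \<open>d - 1 - card (A \<inter> S i) + card (S i) / q\<close> to the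
  off-diagonal discrepancy. The following is a lower bound for this contribution that does not depend
  on \<open>i\<close>: it equals \<open>card (S j) / q - 1\<close> if \<open>A \<subseteq> S j\<close>, \<open>card (S j) / q\<close> if exactly one
  element of \<open>A\<close> lies outside \<open>S j\<close>, and \<open>1\<close> otherwise.
\<close>

definition min_cost :: "nat \<Rightarrow> nat \<Rightarrow> 'j set \<Rightarrow> ('j \<Rightarrow> 'a set) \<Rightarrow> 'a set \<Rightarrow> real" where
  "min_cost q d J S A = 1 +
     (\<Sum>j\<in>J. of_bool (card (A \<inter> S j) = d) * (real (card (S j)) / real q - 2)
           + of_bool (card (A \<inter> S j) = d - 1) * (real (card (S j)) / real q - 1))"

lemma frac_card_le_1: "real (card (T :: 'a::finite set)) / real CARD('a) \<le> 1"
  using card_mono[of UNIV T] by (simp add: divide_le_eq_1)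

lemma card_Int_disjoint_family_le:
  fixes A :: "'a::finite set"
  assumes "disjoint_family_on S J" "j \<in> J" "l \<in> J" "j \<noteq> l"
  shows "card (A \<inter> S j) + card (A \<inter> S l) \<le> card A"
proof -
  have "card (A \<inter> S j) + card (A \<inter> S l) = card ((A \<inter> S j) \<union> (A \<inter> S l))"
    using assms by (subst card_Un_disjoint) (auto simp: disjoint_family_on_def)
  also have "\<dots> \<le> card A" by (intro card_mono) auto
  finally show ?thesis .
qed

text \<open>Both terms of every summand are nonpositive. For points of the remainder this shows that
  leaving them out lowers the total by at most 1 each.\<close>

lemma min_cost_le_1:
  fixes S :: "'j \<Rightarrow> 'a::finite set"
  shows "min_cost CARD('a) d J S A \<le> 1"
proof -
  have "of_bool (card (A \<inter> S j) = d) * (real (card (S j)) / real CARD('a) - 2)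
      + of_bool (card (A \<inter> S j) = d - 1) * (real (card (S j)) / real CARD('a) - 1) \<le> 0" for j
    using order_trans[OF frac_card_le_1[of "S j"], of 2]
    by (intro add_nonpos_nonpos mult_nonneg_nonpos) (simp_all add: frac_card_le_1)
  hence "(\<Sum>j\<in>J. of_bool (card (A \<inter> S j) = d) * (real (card (S j)) / real CARD('a) - 2)
      + of_bool (card (A \<inter> S j) = d - 1) * (real (card (S j)) / real CARD('a) - 1)) \<le> 0"
    by (rule sum_nonpos)
  thus ?thesis
    unfolding min_cost_def by linarith
qed

text \<open>Since \<open>2 * (d - 1) > d\<close>, at most one block holds \<open>d - 1\<close> or
  more elements of \<open>A\<close>. If it is block \<open>i\<close>, equality holds. If it is
  another block, block \<open>i\<close> holds at most one element; if there is none, block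
  \<open>i\<close> holds at most \<open>d - 2\<close>. In both of these cases the right-hand side is
  at least 1.\<close>

lemma min_cost_le:
  fixes S :: "'j \<Rightarrow> 'a::finite set"
  assumes "d \<ge> 3" "finite J" "disjoint_family_on S J" "card A = d" "i \<in> J"
  shows "min_cost CARD('a) d J S A
         \<le> real d - 1 - (real (card (A \<inter> S i)) - real (card (S i)) / real CARD('a))"
proof -
  define s where "s j = real (card (S j)) / real CARD('a)" for j
  have s: "0 \<le> s j" "s j \<le> 1" for j
    using frac_card_le_1[of "S j"] by (auto simp: s_def)
  have le: "card (A \<inter> S j) + card (A \<inter> S l) \<le> d" if "j \<in> J" "l \<in> J" "j \<noteq> l" for j l
    using card_Int_disjoint_family_le[OF assms(3) that, of A] assms(4) by simp
  define h where "h j = of_bool (card (A \<inter> S j) = d) * (s j - 2)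
      + of_bool (card (A \<inter> S j) = d - 1) * (s j - 1)" for j
  have w: "min_cost CARD('a) d J S A = 1 + (\<Sum>j\<in>J. h j)"
    by (simp add: min_cost_def h_def s_def)
  show ?thesis
  proof (cases "\<exists>j\<in>J. card (A \<inter> S j) \<ge> d - 1")
    case True
    then obtain j where j: "j \<in> J" "card (A \<inter> S j) \<ge> d - 1" by blast
    \<comment> \<open>Having \<open>d - 1\<close> elements in block \<open>j\<close> leaves at most
      one for any other block, and \<open>1 < d - 1\<close>, so only the summand of \<open>j\<close>
      survives.\<close>
    have small: "card (A \<inter> S l) \<le> 1" if "l \<in> J" "l \<noteq> j" for l
      using le[OF j(1) that(1) that(2)[symmetric]] j(2) assms(1) by linarith
    have "h l = 0" if "l \<in> J - {j}" for l
      using small[of l] that assms(1) by (auto simp: h_def)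
    hence "min_cost CARD('a) d J S A = 1 + h j"
      using assms(2) j(1) by (simp add: w sum.remove)
    moreover have "1 + h j \<le> real d - 1 - (real (card (A \<inter> S i)) - s i)"
    proof (cases "i = j")
      case True
      have "card (A \<inter> S j) \<le> d" using assms(4) card_mono[of A "A \<inter> S j"] by auto
      hence "card (A \<inter> S j) = d \<or> card (A \<inter> S j) = d - 1" using j(2) by linarith
      thus ?thesis using True assms(1) by (auto simp: h_def)
    next
      case False
      have "h j \<le> 0"
        unfolding h_def using s[of j] by (intro add_nonpos_nonpos mult_nonneg_nonpos) auto
      thus ?thesis using small[OF assms(5) False] s[of i] assms(1) by linarith
    qed
    ultimately show ?thesis by (simp add: s_def)
  next
    case False
    hence "card (A \<inter> S j) < d - 1" if "j \<in> J" for j using that by force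
    note less = this
    have "h j = 0" if "j \<in> J" for j
      using less[OF that] by (auto simp: h_def)
    hence "min_cost CARD('a) d J S A = 1" by (simp add: w)
    moreover have "real (card (A \<inter> S i)) + 2 \<le> real d"
      using less[OF assms(5)] by linarith
    ultimately show ?thesis
      unfolding s_def[symmetric] using s(1)[of i] by linarith
  qed
qed

text \<open>
  Writing \<open>a\<close> and \<open>b\<close> for the numbers of points inside and almost inside a block of relative size
  \<open>s\<close>, the comparison of \<open>a\<close> and \<open>b\<close> gives \<open>s * b \<ge> 2 * (1 - s) * a\<close>, so the negative
  contribution of the \<open>a\<close> points is absorbed by half of the positive one.
\<close>

lemma sum_min_cost_ge:
  fixes \<gamma> :: "'a::{field,finite}" and S :: "'j \<Rightarrow> 'a set"
  assumes "d \<ge> 3" "finite J" "disjoint_family_on S J" "real d / real CARD('a) \<le> y"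
    and y: "\<And>j. j \<in> J \<Longrightarrow> y \<le> real (card (S j)) / real CARD('a)"
      "\<And>j. j \<in> J \<Longrightarrow> y \<le> 1 - real (card (S j)) / real CARD('a)" "y \<le> 1"
  shows "y / 4 * real (card (root_points d \<gamma>))
         \<le> (\<Sum>A\<in>root_points d \<gamma>. min_cost CARD('a) d J S A)"
proof -
  let ?P = "root_points d \<gamma>" and ?q = "real CARD('a)"
  define s where "s j = real (card (S j)) / ?q" for j
  define a where "a j = real (card {A \<in> ?P. card (A \<inter> S j) = d})" for j
  define b where "b j = real (card {A \<in> ?P. card (A \<inter> S j) = d - 1})" for j
  have q: "0 < ?q" by simp
  have count: "(\<Sum>A\<in>?P. of_bool (card (A \<inter> S j) = k)) = real (card {A \<in> ?P. card (A \<inter> S j) = k})"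
    for j k by (simp add: of_bool_def sum.If_cases Int_def)
  have "0 \<le> y" using assms(4) q by (meson divide_nonneg_pos of_nat_0_le_iff order_trans)
  have sum: "(\<Sum>A\<in>?P. min_cost CARD('a) d J S A)
      = real (card ?P) + (\<Sum>j\<in>J. a j * (s j - 2) + b j * (s j - 1))"
  proof -
    have "(\<Sum>A\<in>?P. min_cost CARD('a) d J S A) = real (card ?P)
        + (\<Sum>j\<in>J. \<Sum>A\<in>?P. of_bool (card (A \<inter> S j) = d) * (s j - 2)
                         + of_bool (card (A \<inter> S j) = d - 1) * (s j - 1))"
      unfolding min_cost_def s_def by (subst sum.swap) (simp add: sum.distrib)
    also have "(\<lambda>j. \<Sum>A\<in>?P. of_bool (card (A \<inter> S j) = d) * (s j - 2)
                     + of_bool (card (A \<inter> S j) = d - 1) * (s j - 1))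
        = (\<lambda>j. a j * (s j - 2) + b j * (s j - 1))"
      unfolding sum.distrib sum_distrib_right[symmetric] count a_def b_def ..
    finally show ?thesis .
  qed
  have block: "y / 4 * (a j + b j) \<le> s j * b j - (1 - s j) * a j" if "j \<in> J" for j
  proof -
    have nn: "0 \<le> a j" "0 \<le> b j" by (auto simp: a_def b_def)
    have ys: "y \<le> s j" "y \<le> 1 - s j" using y that by (auto simp: s_def)
    have "real d * a j * (?q - ?q * s j - 1) \<le> (?q * s j) * b j"
      using card_inside_le_card_almost_inside[of d \<gamma> "S j"] assms(1) q
      by (simp add: a_def b_def s_def)
    hence "?q * (real d * a j * (1 - s j) - real d / ?q * a j) \<le> ?q * (s j * b j)"
      using q by (simp add: algebra_simps)
    hence "real d * a j * (1 - s j) - real d / ?q * a j \<le> s j * b j"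
      using q by (simp only: mult_le_cancel_left_pos)
    hence "real d * ((1 - s j) * a j) - real d / ?q * a j \<le> s j * b j"
      by (simp only: mult_ac)
    \<comment> \<open>The loss caused by the forbidden sum is at most one copy of
      \<open>(1 - s j) * a j\<close>; as \<open>d \<ge> 3\<close>, two of the copies remain.\<close>
    moreover have "real d / ?q * a j \<le> (1 - s j) * a j"
      using assms(4) ys nn by (intro mult_right_mono) auto
    moreover have "3 * ((1 - s j) * a j) \<le> real d * ((1 - s j) * a j)"
      using assms(1) nn ys \<open>0 \<le> y\<close> by (intro mult_right_mono mult_nonneg_nonneg) auto
    ultimately have "2 * ((1 - s j) * a j) \<le> s j * b j"
      by linarith
    moreover have "y * a j \<le> (1 - s j) * a j" "y * b j \<le> s j * b j"
      using ys nn by (auto intro!: mult_right_mono)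
    moreover have "0 \<le> y * a j" using \<open>0 \<le> y\<close> nn by simp
    ultimately show ?thesis unfolding distrib_left by linarith
  qed
  \<comment> \<open>No point is inside or almost inside two different blocks, so the counts
    \<open>a j + b j\<close> add up to at most the number of points.\<close>
  let ?E = "\<lambda>j. {A \<in> ?P. card (A \<inter> S j) = d} \<union> {A \<in> ?P. card (A \<inter> S j) = d - 1}"
  have "(\<Sum>j\<in>J. a j + b j) = (\<Sum>j\<in>J. real (card (?E j)))"
    using assms(1) by (intro sum.cong refl, subst card_Un_disjoint) (auto simp: a_def b_def)
  also have "\<dots> = real (card (\<Union>j\<in>J. ?E j))"
  proof -
    have "?E j \<inter> ?E l = {}" if jl: "j \<in> J" "l \<in> J" "j \<noteq> l" for j l
    proof -
      have "card (A \<inter> S j) + card (A \<inter> S l) \<le> d" if "A \<in> ?P" for A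
        using card_Int_disjoint_family_le[OF assms(3) jl, of A] that by (simp add: root_points_def)
      thus ?thesis using assms(1) by fastforce
    qed
    thus ?thesis using assms(2) by (subst card_UN_disjoint) auto
  qed
  also have "\<dots> \<le> real (card ?P)" by (intro of_nat_mono card_mono) auto
  finally have "0 \<le> real (card ?P) - (\<Sum>j\<in>J. a j + b j)" by simp
  \<comment> \<open>The points counted by no \<open>a j\<close> or \<open>b j\<close> have cost 1,
    which is at least \<open>y / 4\<close>.\<close>
  hence "(y / 4) * (real (card ?P) - (\<Sum>j\<in>J. a j + b j))
      \<le> 1 * (real (card ?P) - (\<Sum>j\<in>J. a j + b j))"
    using \<open>y \<le> 1\<close> by (intro mult_right_mono) auto
  moreover have "y / 4 * (\<Sum>j\<in>J. a j + b j) \<le> (\<Sum>j\<in>J. s j * b j - (1 - s j) * a j)"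
    unfolding sum_distrib_left by (intro sum_mono block)
  moreover have "(\<Sum>j\<in>J. a j * (s j - 2) + b j * (s j - 1))
      = (\<Sum>j\<in>J. s j * b j - (1 - s j) * a j) - (\<Sum>j\<in>J. a j + b j)"
    unfolding sum_subtractf[symmetric] by (intro sum.cong) (auto simp: algebra_simps)
  ultimately show ?thesis
    unfolding sum right_diff_distrib by linarith
qed


text \<open>A point placed in a block pays at least its \<open>min_cost\<close> there, while a point
  of \<open>R\<close> pays nothing and forgoes at most 1.\<close>

lemma sum_discrep_deficit_ge:
  fixes \<gamma> :: "'a::{field,finite}"
  assumes "d \<ge> 3" and part: "matched_partitions (root_points d \<gamma>) UNIV m A SS R"
  shows "(\<Sum>B\<in>root_points d \<gamma>. min_cost CARD('a) d {1..m} SS B) - real (card R)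
         \<le> (\<Sum>i\<in>{1..m}. discrep CARD('a) root_inc (A i) UNIV - discrep CARD('a) root_inc (A i) (SS i))"
proof -
  let ?P = "root_points d \<gamma>" and ?w = "min_cost CARD('a) d {1..m} SS"
  have disj: "disjoint_family_on SS {1..m}" "disjoint_family_on A {1..m}"
    and R: "(\<Union>i\<in>{1..m}. A i) \<inter> R = {}" "(\<Union>i\<in>{1..m}. A i) \<union> R = ?P"
    using part by (auto simp: matched_partitions_def)
  have "sum ?w ?P = (\<Sum>B\<in>(\<Union>i\<in>{1..m}. A i). ?w B) + (\<Sum>B\<in>R. ?w B)"
    unfolding R(2)[symmetric] using R(1) by (intro sum.union_disjoint) auto
  also have "(\<Sum>B\<in>(\<Union>i\<in>{1..m}. A i). ?w B) = (\<Sum>i\<in>{1..m}. \<Sum>B\<in>A i. ?w B)"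
    using disj(2) by (intro sum.UNION_disjoint) (auto simp: disjoint_family_on_def)
  also have "(\<Sum>B\<in>R. ?w B) \<le> (\<Sum>B\<in>R. 1)"
    by (intro sum_mono min_cost_le_1)
  finally have 1: "sum ?w ?P - real (card R) \<le> (\<Sum>i\<in>{1..m}. \<Sum>B\<in>A i. ?w B)" by simp
  have "(\<Sum>i\<in>{1..m}. \<Sum>B\<in>A i. ?w B)
      \<le> (\<Sum>i\<in>{1..m}. discrep CARD('a) root_inc (A i) UNIV - discrep CARD('a) root_inc (A i) (SS i))"
  proof (rule sum_mono)
    fix i assume i: "i \<in> {1..m}"
    hence sub: "A i \<subseteq> ?P" unfolding R(2)[symmetric] by blast
    have "(\<Sum>B\<in>A i. ?w B) \<le> (\<Sum>B\<in>A i. (real d - 1)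
            - (real (card (B \<inter> SS i)) - real (card (SS i)) / real CARD('a)))"
      using sub i assms(1) disj(1) by (intro sum_mono min_cost_le) (auto simp: root_points_def)
    also have "\<dots> = (real d - 1) * real (card (A i)) - discrep CARD('a) root_inc (A i) (SS i)"
      unfolding discrep_root_inc[OF finite] sum_subtractf by (simp add: algebra_simps)
    finally show "(\<Sum>B\<in>A i. ?w B)
        \<le> discrep CARD('a) root_inc (A i) UNIV - discrep CARD('a) root_inc (A i) (SS i)"
      using discrep_root_points_UNIV[OF sub] by simp
  qed
  with 1 show ?thesis by linarith
qed

section \<open>Size conditions on the field and the bounds for the root-evaluation system\<close>

lemma root_points_nonempty:
  fixes \<gamma> :: "'a::{field,finite}"
  assumes "d \<ge> 1" "d < CARD('a)"
  shows "root_points d \<gamma> \<noteq> {}"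
proof -
  have "d - 1 \<le> CARD('a)" using assms(2) by linarith
  then obtain B :: "'a set" where B: "card B = d - 1"
    using obtain_subset_with_card_n by metis
  have "real CARD('a) - real (d - 1) - 1 \<le> real (card {u. u \<notin> B \<and> insert u B \<in> root_points d \<gamma>})"
    using card_extensions_ge[OF assms(1) B order_refl] B by simp
  hence "card {u. u \<notin> B \<and> insert u B \<in> root_points d \<gamma>} \<noteq> 0"
    using assms by linarith
  hence "{u. u \<notin> B \<and> insert u B \<in> root_points d \<gamma>} \<noteq> {}" by force
  thus ?thesis by blast
qed

text \<open>As \<open>\<tau> \<le> 1\<close>, a lower bound on \<open>q * \<tau>\<close> also bounds
  \<open>q\<close>. The first conclusion serves the counting lemmas, the second the comparison of
  \<open>d / q\<close> with the block sizes.\<close>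

lemma C_const_le_imp_card_gt:
  assumes "d \<ge> 3" "0 < \<tau>" "\<tau> \<le> 1" "C_const d / \<tau> \<le> q"
  shows "2 * real d + 1 < q" "8 * real d * (real d + 1) \<le> q * \<tau>"
proof -
  show *: "8 * real d * (real d + 1) \<le> q * \<tau>"
    using assms by (simp add: C_const_def pos_divide_le_eq)
  have "0 \<le> 8 * real d * (real d + 1)" by simp
  hence "0 \<le> q * \<tau>" using * by linarith
  hence "0 \<le> q" using assms(2) by (simp add: zero_le_mult_iff)
  hence "q * \<tau> \<le> q" using assms(3) by (simp add: mult_left_le)
  moreover have "8 * real d * 1 \<le> 8 * real d * (real d + 1)"
    by (intro mult_left_mono) auto
  ultimately show "2 * real d + 1 < q" using * assms(1) by linarith
qed

theorem cross_discrep_root_system_ge: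
  fixes \<gamma> :: "'a::{field,finite}"
  assumes "d \<ge> 3" "0 < \<tau>" "\<tau> \<le> 1" "C_const d / \<tau> \<le> real CARD('a)" "m \<ge> 2"
    and part: "matched_partitions (root_points d \<gamma>) UNIV m A SS R"
    and diag: "\<And>i. i \<in> {1..m} \<Longrightarrow> \<tau> * discrep CARD('a) root_inc (root_points d \<gamma>) UNIV
                  \<le> discrep CARD('a) root_inc (A i) (SS i)"
    and rest: "discrep CARD('a) root_inc R UNIV
                \<le> c_const d * \<tau>\<^sup>2 * discrep CARD('a) root_inc (root_points d \<gamma>) UNIV"
  shows "2 * c_const d * \<tau>\<^sup>2 * discrep CARD('a) root_inc (root_points d \<gamma>) UNIV
         \<le> cross_discrep CARD('a) root_inc m A SS"
proof -
  let ?P = "root_points d \<gamma>" and ?q = "real CARD('a)"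
  \<comment> \<open>This is the lower bound on relative block sizes from
    \<open>card_block_ge\<close>.\<close>
  define y where "y = \<tau> * (real d - 1) / (2 * real d)"
  note q = C_const_le_imp_card_gt[OF assms(1-4)]
  have disj: "disjoint_family_on SS {1..m}" and U: "(\<Union>i\<in>{1..m}. SS i) = UNIV"
    and P: "(\<Union>i\<in>{1..m}. A i) \<union> R = ?P"
    using part by (simp_all add: matched_partitions_def)
  have R: "R \<subseteq> ?P" and A: "\<And>i. i \<in> {1..m} \<Longrightarrow> A i \<subseteq> ?P"
    unfolding P[symmetric] by blast+
  have S: "discrep CARD('a) root_inc ?P UNIV = (real d - 1) * real (card ?P)"
    by (rule discrep_root_points_UNIV[OF order_refl])
  have y: "y \<le> real (card (SS i)) / ?q" if "i \<in> {1..m}" for i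
    unfolding y_def using diag[OF that] q(1) assms(1)
    by (intro card_block_ge[OF _ _ A[OF that]]) (simp_all add: S)
  \<comment> \<open>Since \<open>m \<ge> 2\<close>, the complement of a block contains another
    block, of relative size at least \<open>y\<close>.\<close>
  have y': "y \<le> 1 - real (card (SS i)) / ?q" if i: "i \<in> {1..m}" for i
  proof -
    obtain j where j: "j \<in> {1..m}" "j \<noteq> i"
    proof (cases "i = 1")
      case True thus ?thesis using that[of 2] assms(5) by auto
    next
      case False thus ?thesis using that[of 1] assms(5) by auto
    qed
    have "SS i \<inter> SS j = {}" using disj i j by (auto simp: disjoint_family_on_def)
    hence "real (card (SS i)) + real (card (SS j)) = real (card (SS i \<union> SS j))"
      by (subst card_Un_disjoint) auto
    hence "real (card (SS i)) / ?q + real (card (SS j)) / ?q = real (card (SS i \<union> SS j)) / ?q"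
      by (simp flip: add_divide_distrib)
    thus ?thesis using y[OF j(1)] frac_card_le_1[of "SS i \<union> SS j"] by linarith
  qed
  \<comment> \<open>\<open>q * \<tau> \<ge> 8 * d * (d + 1)\<close> exceeds
    \<open>2 * d * d\<close>; this keeps the error from the forbidden sum below the block
    bound.\<close>
  have y1: "real d / ?q \<le> y"
  proof -
    have "2 * real d * real d \<le> 1 * (8 * real d * (real d + 1))"
      by (simp add: algebra_simps)
    also have "\<dots> \<le> 1 * (?q * \<tau>)"
      using q(2) by simp
    also have "\<dots> \<le> (real d - 1) * (?q * \<tau>)"
      using assms(1,2) by (intro mult_right_mono) auto
    finally show ?thesis
      using assms(1) unfolding y_def by (simp add: divide_simps mult_ac)
  qed
  have "y \<le> 1" using y[of 1] y'[of 1] assms(5) frac_card_le_1[of "SS 1"] by auto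
  have R': "real (card R) \<le> c_const d * \<tau>\<^sup>2 * real (card ?P)"
  proof -
    have "(real d - 1) * real (card R) \<le> (real d - 1) * (c_const d * \<tau>\<^sup>2 * real (card ?P))"
      using rest unfolding S discrep_root_points_UNIV[OF R] by (simp add: mult_ac)
    thus ?thesis using assms(1) by (simp add: mult_le_cancel_left_pos)
  qed
  \<comment> \<open>The factor is the target \<open>2 * (d - 1)\<close> plus 1 for the loss through
    \<open>R\<close>. With \<open>2 * d - 1 \<le> 4 * d\<close> and
    \<open>\<tau> * \<tau> \<le> \<tau>\<close>, the value of \<open>c_const\<close> gives exactly
    \<open>y / 4\<close>.\<close>
  have "c_const d * \<tau>\<^sup>2 * (2 * (real d - 1) + 1) \<le> y / 4"
  proof -
    have "c_const d * \<tau>\<^sup>2 * (2 * (real d - 1) + 1) = (real d - 1) / (32 * (real d)\<^sup>2) * (\<tau> * \<tau>) * (2 * real d - 1)"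
      by (simp add: c_const_def power2_eq_square)
    also have "\<dots> \<le> (real d - 1) / (32 * (real d)\<^sup>2) * (\<tau> * 1) * (4 * real d)"
      using assms(1-3) by (intro mult_mono mult_left_mono) auto
    also have "\<dots> = y / 4"
      using assms(1) by (simp add: y_def field_simps power2_eq_square)
    finally show ?thesis .
  qed
  hence "c_const d * \<tau>\<^sup>2 * (2 * (real d - 1) + 1) * real (card ?P) \<le> y / 4 * real (card ?P)"
    by (intro mult_right_mono) auto
  hence "2 * c_const d * \<tau>\<^sup>2 * ((real d - 1) * real (card ?P))
      \<le> y / 4 * real (card ?P) - c_const d * \<tau>\<^sup>2 * real (card ?P)"
    by (simp add: algebra_simps)
  also have "\<dots> \<le> (\<Sum>B\<in>?P. min_cost CARD('a) d {1..m} SS B) - real (card R)"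
    using sum_min_cost_ge[where \<gamma> = \<gamma> and J = "{1..m}" and S = SS, OF assms(1) _ disj y1 y y' \<open>y \<le> 1\<close>] R'
    by (intro diff_mono) auto
  also have "\<dots> \<le> cross_discrep CARD('a) root_inc m A SS"
    using sum_discrep_deficit_ge[OF assms(1) part]
      cross_discrep_ge[OF disj, where q = "CARD('a)" and inc = root_inc and A = A]
    unfolding U by linarith
  finally show ?thesis unfolding S .
qed

corollary no_centered_block_decomposition_root_system:
  fixes \<gamma> :: "'a::{field,finite}"
  assumes "d \<ge> 3" "0 < \<tau>" "\<tau> \<le> 1" "C_const d / \<tau> \<le> real CARD('a)" "\<epsilon> \<le> c_const d * \<tau>\<^sup>2"
  shows "\<not> has_centered_block_decomposition CARD('a) root_inc (root_points d \<gamma>) UNIV \<tau> \<epsilon>"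
proof
  let ?\<Sigma> = "discrep CARD('a) root_inc (root_points d \<gamma>) UNIV"
  assume "has_centered_block_decomposition CARD('a) root_inc (root_points d \<gamma>) UNIV \<tau> \<epsilon>"
  then obtain m A SS R where *: "m \<ge> 2" "matched_partitions (root_points d \<gamma>) UNIV m A SS R"
    "\<forall>i\<in>{1..m}. \<tau> * ?\<Sigma> \<le> discrep CARD('a) root_inc (A i) (SS i)"
    "discrep CARD('a) root_inc R UNIV \<le> \<epsilon> * ?\<Sigma>"
    "cross_discrep CARD('a) root_inc m A SS \<le> \<epsilon> * ?\<Sigma>"
    unfolding has_centered_block_decomposition_def by blast
  \<comment> \<open>Positivity of the total discrepancy lets \<open>\<epsilon>\<close> be replaced
    by its bound, and makes twice that bound strictly larger than the bound at the end.\<close>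
  have "root_points d \<gamma> \<noteq> {}"
    using C_const_le_imp_card_gt(1)[OF assms(1-4)] assms(1) by (intro root_points_nonempty) linarith+
  hence "0 < real (card (root_points d \<gamma>))" by (simp add: card_gt_0_iff)
  hence "0 < ?\<Sigma>"
    using assms(1) unfolding discrep_root_points_UNIV[OF order_refl] by (intro mult_pos_pos) auto
  hence eps: "\<epsilon> * ?\<Sigma> \<le> c_const d * \<tau>\<^sup>2 * ?\<Sigma>" using assms(5) by (intro mult_right_mono) auto
  have "2 * c_const d * \<tau>\<^sup>2 * ?\<Sigma> \<le> cross_discrep CARD('a) root_inc m A SS"
    using * eps by (intro cross_discrep_root_system_ge[OF assms(1-4)]) auto
  moreover have "0 < c_const d * \<tau>\<^sup>2 * ?\<Sigma>"
    using \<open>0 < ?\<Sigma>\<close> assms(1,2) by (intro mult_pos_pos) (auto simp: c_const_def)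
  ultimately show False using *(5) eps by linarith
qed


section \<open>Transfer along an isomorphism of incidence systems\<close>

text \<open>Parts are transported as preimages, so that disjointness and covering carry over
  directly; bijectivity preserves the cardinalities and the incidence count.\<close>

lemma discrep_vimage:
  assumes "bij_betw F P P'" "bij_betw G S S'"
    and inc: "\<And>p s. p \<in> P \<Longrightarrow> s \<in> S \<Longrightarrow> inc' (F p) (G s) \<longleftrightarrow> inc p s"
    and "B \<subseteq> P'" "T \<subseteq> S'"
  shows "discrep q inc {p \<in> P. F p \<in> B} {s \<in> S. G s \<in> T} = discrep q inc' B T"
proof -
  have F: "bij_betw F {p \<in> P. F p \<in> B} B"
    using assms(1,4) by (auto simp: bij_betw_def inj_on_def)
  have G: "bij_betw G {s \<in> S. G s \<in> T} T"
    using assms(2,5) by (auto simp: bij_betw_def inj_on_def)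
  have "bij_betw (map_prod F G)
      {(p, s). p \<in> {p \<in> P. F p \<in> B} \<and> s \<in> {s \<in> S. G s \<in> T} \<and> inc p s}
      {(p, s). p \<in> B \<and> s \<in> T \<and> inc' p s}"
  proof (rule bij_betw_imageI)
    have "inj_on (map_prod F G) (P \<times> S)"
      using assms(1,2) by (intro map_prod_inj_on) (auto simp: bij_betw_def)
    thus "inj_on (map_prod F G)
      {(p, s). p \<in> {p \<in> P. F p \<in> B} \<and> s \<in> {s \<in> S. G s \<in> T} \<and> inc p s}"
      by (rule inj_on_subset) auto
    have "P' = F ` P" "S' = G ` S" using assms(1,2) by (auto simp: bij_betw_def)
    hence im: "B \<subseteq> F ` P" "T \<subseteq> G ` S" using assms(4,5) by auto
    show "map_prod F G ` {(p, s). p \<in> {p \<in> P. F p \<in> B} \<and> s \<in> {s \<in> S. G s \<in> T} \<and> inc p s}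
      = {(p, s). p \<in> B \<and> s \<in> T \<and> inc' p s}" (is "?l = ?r")
    proof
      show "?l \<subseteq> ?r" by (auto simp: inc)
      show "?r \<subseteq> ?l"
      proof clarify
        fix p' s' assume *: "p' \<in> B" "s' \<in> T" "inc' p' s'"
        obtain p s where ps: "p \<in> P" "p' = F p" "s \<in> S" "s' = G s"
          using * im by blast
        hence "inc p s" using * inc by simp
        thus "(p', s') \<in> ?l" using * ps by (intro image_eqI[of _ _ "(p, s)"]) auto
      qed
    qed
  qed
  hence "incidences inc {p \<in> P. F p \<in> B} {s \<in> S. G s \<in> T} = incidences inc' B T"
    unfolding incidences_def by (rule bij_betw_same_card)
  thus ?thesis
    using bij_betw_same_card[OF F] bij_betw_same_card[OF G] by (simp add: discrep_def)
qed

lemma matched_partitions_vimage: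
  assumes "bij_betw F P P'" "bij_betw G S S'" "matched_partitions P' S' m A SS R"
  shows "matched_partitions P S m (\<lambda>i. {p \<in> P. F p \<in> A i}) (\<lambda>i. {s \<in> S. G s \<in> SS i})
           {p \<in> P. F p \<in> R}"
proof -
  have P': "(\<Union>i\<in>{1..m}. A i) \<union> R = P'" and S': "(\<Union>i\<in>{1..m}. SS i) = S'"
    using assms(3) by (simp_all add: matched_partitions_def)
  have F: "F p \<in> (\<Union>i\<in>{1..m}. A i) \<union> R" if "p \<in> P" for p
    unfolding P' by (rule bij_betw_apply[OF assms(1) that])
  have G: "G s \<in> (\<Union>i\<in>{1..m}. SS i)" if "s \<in> S" for s
    unfolding S' by (rule bij_betw_apply[OF assms(2) that])
  have "disjoint_family_on A {1..m}" "disjoint_family_on SS {1..m}" "(\<Union>i\<in>{1..m}. A i) \<inter> R = {}"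
    using assms(3) by (simp_all add: matched_partitions_def)
  hence "disjoint_family_on (\<lambda>i. {p \<in> P. F p \<in> A i}) {1..m}"
    "disjoint_family_on (\<lambda>i. {s \<in> S. G s \<in> SS i}) {1..m}"
    "(\<Union>i\<in>{1..m}. {p \<in> P. F p \<in> A i}) \<inter> {p \<in> P. F p \<in> R} = {}"
    unfolding disjoint_family_on_def by blast+
  moreover have "(\<Union>i\<in>{1..m}. {s \<in> S. G s \<in> SS i}) = S"
    "(\<Union>i\<in>{1..m}. {p \<in> P. F p \<in> A i}) \<union> {p \<in> P. F p \<in> R} = P"
    using F G by auto
  ultimately show ?thesis
    unfolding matched_partitions_def by simp
qed

lemma has_centered_block_decomposition_iso:
  assumes bij: "bij_betw F P P'" "bij_betw G S S'"
    and inc: "\<And>p s. p \<in> P \<Longrightarrow> s \<in> S \<Longrightarrow> inc' (F p) (G s) \<longleftrightarrow> inc p s"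
    and "has_centered_block_decomposition q inc' P' S' \<tau> \<epsilon>"
  shows "has_centered_block_decomposition q inc P S \<tau> \<epsilon>"
proof -
  obtain m A SS R where *: "m \<ge> 2" "matched_partitions P' S' m A SS R"
    "\<forall>i\<in>{1..m}. \<tau> * discrep q inc' P' S' \<le> discrep q inc' (A i) (SS i)"
    "discrep q inc' R S' \<le> \<epsilon> * discrep q inc' P' S'"
    "cross_discrep q inc' m A SS \<le> \<epsilon> * discrep q inc' P' S'"
    using assms(4) unfolding has_centered_block_decomposition_def by blast
  let ?A = "\<lambda>i. {p \<in> P. F p \<in> A i}" and ?SS = "\<lambda>i. {s \<in> S. G s \<in> SS i}"
    and ?R = "{p \<in> P. F p \<in> R}"
  have P': "(\<Union>i\<in>{1..m}. A i) \<union> R = P'" and S': "(\<Union>i\<in>{1..m}. SS i) = S'"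
    using *(2) by (simp_all add: matched_partitions_def)
  have sub: "A i \<subseteq> P'" "SS i \<subseteq> S'" if "i \<in> {1..m}" for i
    using that unfolding P'[symmetric] S'[symmetric] by blast+
  have "R \<subseteq> P'" unfolding P'[symmetric] by blast
  note eq = discrep_vimage[where inc = inc and inc' = inc', OF bij inc]
  have P: "{p \<in> P. F p \<in> P'} = P" and S: "{s \<in> S. G s \<in> S'} = S"
    using bij by (auto simp: bij_betw_def)
  have "discrep q inc P S = discrep q inc' P' S'"
    using eq[OF _ _ order_refl order_refl] unfolding P S by simp
  moreover have "discrep q inc ?R S = discrep q inc' R S'"
    using eq[OF _ _ \<open>R \<subseteq> P'\<close> order_refl] unfolding S by simp
  moreover have "discrep q inc (?A i) (?SS j) = discrep q inc' (A i) (SS j)"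
    if "i \<in> {1..m}" "j \<in> {1..m}" for i j
    using eq sub that by blast
  moreover from this have "cross_discrep q inc m ?A ?SS = cross_discrep q inc' m A SS"
    unfolding cross_discrep_def by (intro sum.cong) auto
  ultimately show ?thesis
    using * matched_partitions_vimage[OF bij *(2)]
    unfolding has_centered_block_decomposition_def
    by (intro exI[of _ m] exI[of _ ?A] exI[of _ ?SS] exI[of _ ?R]) auto
qed


section \<open>The rational-normal-curve sphere system\<close>

text \<open>Summing all elements of the field and translating by \<open>1\<close> shows that the cardinality vanishes
  in the field.\<close>

lemma two_neq_zero_of_odd_card:
  assumes "odd CARD('a::{field,finite})"
  shows "(2::'a) \<noteq> 0"
proof
  assume two: "(2::'a) = 0"
  have "(\<Sum>x\<in>UNIV. x :: 'a) = (\<Sum>x\<in>UNIV. x + 1)"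
    by (rule sum.reindex_bij_witness[of _ "\<lambda>x. x + 1" "\<lambda>x. x - 1"]) auto
  hence "of_nat CARD('a) = (0::'a)" by (simp add: sum.distrib)
  moreover obtain k where "CARD('a) = 2 * k + 1" using assms oddE by blast
  ultimately show False using two by simp
qed

text \<open>In the third claim \<open>pCons 0\<close> shifts indices by one: it concerns the
  coefficient at \<open>card A - 1\<close> without a truncated subtraction and stays true for the
  empty set.\<close>

lemma coeff_prod_linear_factors:
  fixes A :: "'a::comm_ring_1 set"
  assumes "finite A"
  shows "coeff (\<Prod>a\<in>A. [:- a, 1:]) (card A) = 1"
    and "card A < n \<Longrightarrow> coeff (\<Prod>a\<in>A. [:- a, 1:]) n = 0"
    and "coeff (pCons 0 (\<Prod>a\<in>A. [:- a, 1:])) (card A) = - \<Sum>A"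
  using assms
proof (induction A arbitrary: n rule: finite_induct)
  case (insert a A)
  {
    case 1
    show ?case using insert by simp
  next
    case (2 n)
    thus ?case using insert by (cases n) (simp_all add: insert.IH)
  next
    case 3
    show ?case using insert by simp
  }
qed auto

lemma poly_prod_linear_factors_eq_0_iff:
  fixes A :: "'a::idom set"
  assumes "finite A"
  shows "poly (\<Prod>a\<in>A. [:- a, 1:]) t = 0 \<longleftrightarrow> t \<in> A"
  using assms by (auto simp: poly_prod)

text \<open>Fix \<open>d - 1\<close> elements including \<open>t\<close> and avoiding
  \<open>t'\<close>; the last one has to avoid these, \<open>t'\<close> and one forbidden value,
  which \<open>d + 1 < q\<close> permits. This later shows that distinct parameters give distinct
  spheres.\<close>

lemma root_points_separate:
  fixes t t' :: "'a::{field,finite}"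
  assumes "d \<ge> 2" "d + 1 < CARD('a)" "t \<noteq> t'"
  shows "\<exists>A\<in>root_points d \<gamma>. t \<in> A \<and> t' \<notin> A"
proof -
  have "card (UNIV - {t, t'}) = CARD('a) - 2"
    using assms(3) by (subst card_Diff_subset) auto
  hence "d - 2 \<le> card (UNIV - {t, t'})" using assms(2) by linarith
  then obtain B where B: "B \<subseteq> UNIV - {t, t'}" "card B = d - 2"
    by (rule obtain_subset_with_card_n) blast
  have c: "card (insert t B) = d - 1" "card (insert t' (insert t B)) = d"
    using B assms(1,3) by (subst card_insert_disjoint; force)+
  have "real CARD('a) - real d - 1
      \<le> real (card {u. u \<notin> insert t' (insert t B) \<and> insert u (insert t B) \<in> root_points d \<gamma>})"
    using card_extensions_ge[of d "insert t B" "insert t' (insert t B)" \<gamma>] c assms(1) by auto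
  hence "card {u. u \<notin> insert t' (insert t B) \<and> insert u (insert t B) \<in> root_points d \<gamma>} \<noteq> 0"
    using assms(2) by linarith
  hence "{u. u \<notin> insert t' (insert t B) \<and> insert u (insert t B) \<in> root_points d \<gamma>} \<noteq> {}"
    by (metis card.empty)
  then obtain u where "u \<notin> insert t' (insert t B)" "insert u (insert t B) \<in> root_points d \<gamma>"
    by blast
  thus ?thesis using B assms(3) by (intro bexI[of _ "insert u (insert t B)"]) auto
qed

section \<open>Sphere incidence in Witt coordinates\<close>

context rational_normal_system
begin

context
  assumes adm: admissible and d: "d \<ge> 3" and two: "(2::'a) \<noteq> 0"
begin

lemma linear_qinner: "Vector_Spaces.linear (*s) (*) (qinner Q x)"
  using adm by (auto simp: admissible_def quadratic_form_def)

lemma qinner_commute: "qinner Q x y = qinner Q y x"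
  by (simp add: qinner_def add.commute)

lemma two_qinner: "2 * qinner Q x y = Q (x + y) - Q x - Q y"
  using two by (simp add: qinner_def)

lemma Q_diff: "Q (x - y) = Q x + Q y - 2 * qinner Q x y"
proof -
  interpret L: Vector_Spaces.linear "(*s)" "(*)" "qinner Q x" by (rule linear_qinner)
  have "Q ((-1) *s y) = (-1)\<^sup>2 * Q y"
    using adm unfolding admissible_def quadratic_form_def by blast
  hence "Q (- y) = Q y" by simp
  moreover have "qinner Q x (- y) = - qinner Q x y" by (rule L.neg)
  ultimately show ?thesis using two_qinner[of x "- y"] by (simp add: algebra_simps)
qed

lemma subspace_V0: "vec.subspace V0"
  using adm by (auto simp: admissible_def witt_decomposition_def)

lemma nondegenerate_V0: "nondegenerate_on V0 Q"
  using adm by (auto simp: admissible_def witt_decomposition_def)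

lemma Q_coords: "z \<in> V0 \<Longrightarrow> Q (x *s e + y *s f + z) = x * y + Q z"
  using adm by (auto simp: admissible_def witt_decomposition_def)

lemma span_u: "vec.span (u ` {1..d - 2}) = V0"
  using adm by (auto simp: admissible_def)

lemma sum_u_mem_V0: "(\<Sum>j=1..d - 2. h j *s u j) \<in> V0"
  unfolding span_u[symmetric] by (intro vec.span_sum vec.span_scale vec.span_base) auto

text \<open>In the expansion of \<open>Q (p - center t)\<close> the term \<open>Q (center t)\<close>
  cancels against the one in \<open>radius t\<close>. The polar form pairs \<open>x *s e\<close>
  with the \<open>f\<close>-part of the center to \<open>x * t ^ (d - 1)\<close>, and
  \<open>z\<close> with the rest to the middle terms of \<open>Psi\<close>.\<close>

lemma mem_qsphere_iff_poly_Psi: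
  assumes z: "z \<in> V0"
  shows "x *s e + y *s f + z \<in> qsphere Q (center t) (radius t) \<longleftrightarrow> poly (Psi x y z) t = 0"
proof -
  define w where "w = (\<Sum>j=1..d - 2. t ^ j *s u j)"
  define p where "p = x *s e + y *s f + z"
  interpret L: Vector_Spaces.linear "(*s)" "(*)" "qinner Q z" by (rule linear_qinner)
  have w: "w \<in> V0" unfolding w_def by (rule sum_u_mem_V0)
  have c: "center t = t ^ (d - 1) *s f + w" by (simp add: center_def w_def)
  have "p + center t = x *s e + (y + t ^ (d - 1)) *s f + (z + w)"
    unfolding p_def c by (simp add: vec.scale_left_distrib algebra_simps)
  moreover have "z + w \<in> V0" using subspace_V0 z w by (rule vec.subspace_add)
  ultimately have "Q (p + center t) = x * (y + t ^ (d - 1)) + Q (z + w)"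
    using Q_coords by (simp only:)
  moreover have "Q p = x * y + Q z" unfolding p_def by (rule Q_coords[OF z])
  \<comment> \<open>The center has no \<open>e\<close>-component, so its \<open>f\<close>-component
    contributes nothing to \<open>Q\<close>.\<close>
  moreover have "Q (center t) = Q w"
    using Q_coords[OF w, of 0 "t ^ (d - 1)"] by (simp add: c)
  ultimately have "2 * qinner Q p (center t) = x * t ^ (d - 1) + 2 * qinner Q z w"
    by (simp add: two_qinner algebra_simps)
  moreover have "qinner Q z w = (\<Sum>j=1..d - 2. t ^ j * qinner Q z (u j))"
    unfolding w_def by (simp add: L.sum L.scale)
  ultimately have "p \<in> qsphere Q (center t) (radius t)
      \<longleftrightarrow> Q p - (x * t ^ (d - 1) + (\<Sum>j=1..d - 2. 2 * (t ^ j * qinner Q z (u j))))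
          = t ^ d + gam * t ^ (d - 1) + \<kappa>"
    by (simp add: qsphere_def Q_diff radius_def algebra_simps sum_distrib_left)
  also have "\<dots> \<longleftrightarrow> poly (Psi x y z) t = 0"
    unfolding Psi_def p_def[symmetric]
    by (auto simp: poly_monom poly_sum algebra_simps)
  finally show ?thesis unfolding p_def .
qed

text \<open>The difference is orthogonal to a spanning set of \<open>V0\<close>, hence zero by
  nondegeneracy on \<open>V0\<close>.\<close>

lemma eq_if_qinner_u_eq:
  assumes "z \<in> V0" "z' \<in> V0" and eq: "\<And>j. j \<in> {1..d - 2} \<Longrightarrow> qinner Q z (u j) = qinner Q z' (u j)"
  shows "z = z'"
proof -
  interpret L: Vector_Spaces.linear "(*s)" "(*)" "qinner Q (z - z')" by (rule linear_qinner)
  have diff: "qinner Q (z - z') v = qinner Q z v - qinner Q z' v" for v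
  proof -
    interpret M: Vector_Spaces.linear "(*s)" "(*)" "qinner Q v" by (rule linear_qinner)
    show ?thesis
      unfolding qinner_commute[of "z - z'" v] qinner_commute[of z v] qinner_commute[of z' v]
      by (rule M.diff)
  qed
  have "qinner Q (z - z') v = 0" if "v \<in> V0" for v
  proof (rule L.eq_0_on_span)
    show "v \<in> vec.span (u ` {1..d - 2})" using that span_u by simp
    show "qinner Q (z - z') b = 0" if "b \<in> u ` {1..d - 2}" for b
      using that eq by (auto simp: diff)
  qed
  moreover have "z - z' \<in> V0" using subspace_V0 assms(1,2) by (rule vec.subspace_diff)
  ultimately have "z - z' = 0"
    using nondegenerate_V0 unfolding nondegenerate_on_def by blast
  thus ?thesis by simp
qed

lemma sum_u_eqD:
  assumes "(\<Sum>i=1..d - 2. h i *s u i) = (\<Sum>i=1..d - 2. h' i *s u i)" "j \<in> {1..d - 2}"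
  shows "h j = h' j"
proof -
  let ?I = "{1..d - 2}"
  have inj: "inj_on u ?I" and ind: "vec.independent (u ` ?I)"
    using adm by (simp_all add: admissible_def)
  \<comment> \<open>Independence speaks of a set of vectors, so the coefficients are re-indexed by
    vectors through the injective \<open>u\<close>.\<close>
  define k where "k v = h (inv_into ?I u v) - h' (inv_into ?I u v)" for v
  have k: "k (u i) = h i - h' i" if "i \<in> ?I" for i
    unfolding k_def inv_into_f_f[OF inj that] ..
  have "(\<Sum>v\<in>u ` ?I. k v *s v) = (\<Sum>i\<in>?I. k (u i) *s u i)"
    unfolding sum.reindex[OF inj] o_def ..
  also have "\<dots> = (\<Sum>i\<in>?I. h i *s u i - h' i *s u i)"
    by (intro sum.cong) (auto simp: k vec.scale_left_diff_distrib)
  also have "\<dots> = 0" using assms(1) by (simp add: sum_subtractf)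
  finally have "k (u j) = 0"
    by (rule vec.independentD[OF ind finite_imageI[OF finite_atLeastAtMost] order_refl])
      (use assms(2) in blast)
  thus ?thesis using k[OF assms(2)] by simp
qed

text \<open>The Gram map of the basis is an injective self-map of the finite set of coordinate vectors.\<close>

lemma ex_qinner_u_eq:
  "\<exists>z\<in>V0. \<forall>j\<in>{1..d - 2}. 2 * qinner Q z (u j) = c j"
proof -
  let ?I = "{1..d - 2}"
  let ?X = "?I \<rightarrow>\<^sub>E (UNIV :: 'a set)"
  define z where "z h = (\<Sum>i=1..d - 2. h i *s u i)" for h
  define \<phi> where "\<phi> h = (\<lambda>j\<in>?I. 2 * qinner Q (z h) (u j))" for h
  have z: "z h \<in> V0" for h unfolding z_def by (rule sum_u_mem_V0)
  have \<phi>: "\<phi> h j = 2 * qinner Q (z h) (u j)" if "j \<in> ?I" for h j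
    using that by (simp add: \<phi>_def)
  have "inj_on \<phi> ?X"
  proof (rule inj_onI)
    fix h h' assume *: "h \<in> ?X" "h' \<in> ?X" "\<phi> h = \<phi> h'"
    have "qinner Q (z h) (u j) = qinner Q (z h') (u j)" if "j \<in> ?I" for j
      using \<phi>[OF that, of h] \<phi>[OF that, of h'] *(3) two by simp
    hence "z h = z h'" by (rule eq_if_qinner_u_eq[OF z z])
    hence "h j = h' j" if "j \<in> ?I" for j
      using sum_u_eqD[OF _ that, of h h'] by (simp only: z_def)
    with *(1,2) show "h = h'" by (rule PiE_ext)
  qed
  moreover have "finite ?X" by (intro finite_PiE) auto
  moreover have "\<phi> ` ?X \<subseteq> ?X" by (auto simp: \<phi>_def)
  ultimately have "\<phi> ` ?X = ?X" by (metis endo_inj_surj)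
  moreover have "restrict c ?I \<in> ?X" by auto
  ultimately have "restrict c ?I \<in> \<phi> ` ?X" by (simp only:)
  then obtain h where h: "restrict c ?I = \<phi> h" by (rule imageE)
  have "2 * qinner Q (z h) (u j) = c j" if "j \<in> ?I" for j
    using fun_cong[OF h, of j] \<phi>[OF that, of h] that by simp
  thus ?thesis using z by blast
qed

section \<open>Coefficients and inversion of \<open>Psi\<close>\<close>

lemma coeff_Psi:
  "coeff (Psi x y z) n =
     (if n = d then 1 else if n = d - 1 then x + gam
      else if n \<in> {1..d - 2} then 2 * qinner Q z (u n)
      else if n = 0 then \<kappa> - Q (x *s e + y *s f + z) else 0)"
proof -
  have "(\<Sum>j=1..d - 2. coeff (monom (2 * qinner Q z (u j)) j) n)
      = (if n \<in> {1..d - 2} then 2 * qinner Q z (u n) else 0)"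
    unfolding coeff_monom by (subst sum.delta) auto
  thus ?thesis
    using d by (auto simp: Psi_def coeff_sum coeff_pCons split: nat.split)
qed

text \<open>The coefficients are solved in turn: degree \<open>d - 1\<close> gives \<open>x\<close>,
  degrees \<open>1\<close> to \<open>d - 2\<close> give \<open>z\<close>, and the constant term
  gives \<open>y\<close>. The excluded sum is exactly what makes \<open>x\<close> nonzero.\<close>

lemma ex_Psi_eq:
  assumes "A \<in> root_points d gam"
  shows "\<exists>x y z. x \<noteq> 0 \<and> z \<in> V0 \<and> Psi x y z = (\<Prod>a\<in>A. [:- a, 1:])"
proof -
  let ?p = "\<Prod>a\<in>A. [:- a, 1:]"
  have A: "finite A" "card A = d" "- \<Sum>A \<noteq> gam" using assms by (auto simp: root_points_def)
  note p = coeff_prod_linear_factors[OF A(1), unfolded A(2)]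
  define x where "x = - \<Sum>A - gam"
  have x: "x \<noteq> 0" using A(3) by (simp add: x_def)
  obtain z where z: "z \<in> V0" "\<And>j. j \<in> {1..d - 2} \<Longrightarrow> 2 * qinner Q z (u j) = coeff ?p j"
    using ex_qinner_u_eq by blast
  \<comment> \<open>On these coordinates \<open>Q\<close> equals \<open>x * y + Q z\<close>, so the
    constant term is linear in \<open>y\<close> with nonzero slope.\<close>
  define y where "y = (\<kappa> - coeff ?p 0 - Q z) / x"
  have "coeff ?p (d - 1) = - \<Sum>A" using p(3) d by (cases d) auto
  moreover have "Q (x *s e + y *s f + z) = \<kappa> - coeff ?p 0"
    using x by (simp add: Q_coords[OF z(1)] y_def)
  moreover have "n \<le> d - 2 \<or> n = d - 1 \<or> n = d \<or> d < n" for n by linarith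
  ultimately have "Psi x y z = ?p"
    using p z(2) d by (intro poly_eqI) (fastforce simp: coeff_Psi x_def)
  thus ?thesis using x z(1) by blast
qed

text \<open>The coefficients are read in the same order; \<open>y\<close> can be cancelled from the
  constant term because \<open>x \<noteq> 0\<close>.\<close>

lemma Psi_inject:
  assumes "Psi x y z = Psi x' y' z'" "x \<noteq> 0" "z \<in> V0" "z' \<in> V0"
  shows "x = x'" "y = y'" "z = z'"
proof -
  have c: "coeff (Psi x y z) n = coeff (Psi x' y' z') n" for n using assms(1) by simp
  show x: "x = x'" using c[of "d - 1"] d by (simp add: coeff_Psi split: if_splits)
  have "qinner Q z (u j) = qinner Q z' (u j)" if j: "j \<in> {1..d - 2}" for j
  proof -
    have "j \<noteq> d" "j \<noteq> d - 1" using j d by auto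
    thus ?thesis using c[of j] j two by (simp add: coeff_Psi)
  qed
  thus z: "z = z'" by (rule eq_if_qinner_u_eq[OF assms(3,4)])
  show "y = y'"
    using c[of 0] d x z assms(2) by (simp add: coeff_Psi Q_coords[OF assms(4)])
qed

text \<open>Existence and uniqueness of the preimage under \<open>Psi\<close> justify the
  \<open>THE\<close> in \<open>root_point\<close>; incidence then means being a root of the product
  of linear factors.\<close>

lemma root_point_mem_qsphere_iff:
  assumes "A \<in> root_points d gam"
  shows "root_point A \<in> qsphere Q (center t) (radius t) \<longleftrightarrow> t \<in> A"
proof -
  let ?R = "\<lambda>p. \<exists>x y z. x \<noteq> 0 \<and> z \<in> V0 \<and> p = x *s e + y *s f + z \<and>
                     Psi x y z = (\<Prod>a\<in>A. [:- a, 1:])"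
  have "\<exists>!p. ?R p"
  proof (rule ex_ex1I)
    show "\<exists>p. ?R p" using ex_Psi_eq[OF assms] by blast
    show "p = p'" if "?R p" "?R p'" for p p'
      using that Psi_inject by metis
  qed
  hence "?R (root_point A)" unfolding root_point_def by (rule theI')
  then obtain x y z where "z \<in> V0" "root_point A = x *s e + y *s f + z"
    "Psi x y z = (\<Prod>a\<in>A. [:- a, 1:])" by blast
  moreover have "finite A" by simp
  ultimately show ?thesis
    by (simp add: mem_qsphere_iff_poly_Psi poly_prod_linear_factors_eq_0_iff)
qed

text \<open>\<open>A\<close> is recovered from its point as the set of all \<open>t\<close> whose
  sphere contains that point.\<close>

lemma bij_betw_root_point: "bij_betw root_point (root_points d gam) points"
  unfolding points_def
proof (rule bij_betw_imageI[OF inj_onI refl])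
  fix A A' assume *: "A \<in> root_points d gam" "A' \<in> root_points d gam" "root_point A = root_point A'"
  have "t \<in> A \<longleftrightarrow> t \<in> A'" for t
    using root_point_mem_qsphere_iff[OF *(1), of t] root_point_mem_qsphere_iff[OF *(2), of t] *(3)
    by simp
  thus "A = A'" by blast
qed

text \<open>As \<open>spheres\<close> is a set, coinciding spheres would be merged. A root set
  containing \<open>t\<close> but not \<open>t'\<close> yields a point on only one of the two
  spheres.\<close>

lemma bij_betw_qsphere:
  assumes "d + 1 < CARD('a)"
  shows "bij_betw (\<lambda>t. qsphere Q (center t) (radius t)) UNIV spheres"
proof (rule bij_betw_imageI[OF inj_onI])
  fix t t' assume eq: "qsphere Q (center t) (radius t) = qsphere Q (center t') (radius t')"
  show "t = t'"
  proof (rule ccontr)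
    assume "t \<noteq> t'"
    then obtain A where "A \<in> root_points d gam" "t \<in> A" "t' \<notin> A"
      using root_points_separate[of d t t' gam] assms d by auto
    thus False using eq root_point_mem_qsphere_iff[of A] by metis
  qed
qed (auto simp: spheres_def)

lemma no_centered_block_decomposition_spheres:
  assumes "0 < \<tau>" "\<tau> \<le> 1" "C_const d / \<tau> \<le> real CARD('a)" "\<epsilon> \<le> c_const d * \<tau>\<^sup>2"
  shows "\<not> has_centered_block_decomposition CARD('a) (\<in>) points spheres \<tau> \<epsilon>"
proof
  have "d + 1 < CARD('a)"
    using C_const_le_imp_card_gt(1)[OF d assms(1-3)] by linarith
  note bij = bij_betw_root_point bij_betw_qsphere[OF this]
  assume "has_centered_block_decomposition CARD('a) (\<in>) points spheres \<tau> \<epsilon>"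
  \<comment> \<open>The assumed decomposition is pulled back from the spheres to the root system,
    where it is already excluded.\<close>
  hence "has_centered_block_decomposition CARD('a) root_inc (root_points d gam) UNIV \<tau> \<epsilon>"
    by (rule has_centered_block_decomposition_iso[OF bij, rotated])
      (simp only: root_inc_def root_point_mem_qsphere_iff)
  thus False
    using no_centered_block_decomposition_root_system[OF d assms] by blast
qed

end

end

theorem theorem4p12:
  fixes d :: nat and \<tau> :: real
  assumes "d \<ge> 3"
    and "0 < \<tau>" and "\<tau> \<le> 1"
    and "odd CARD('a::{field,finite})"
    and "real CARD('a) \<ge> C_const d / \<tau>"
  shows
    "(\<forall>(\<gamma>::'a) \<epsilon>. 0 \<le> \<epsilon> \<and> \<epsilon> \<le> c_const d * \<tau>\<^sup>2 \<longrightarrow>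
        \<not> has_centered_block_decomposition CARD('a) root_inc (root_points d \<gamma>) UNIV \<tau> \<epsilon>)
     \<and>
     (\<forall>(Q :: 'a ^ 'n \<Rightarrow> 'a) e f V0 u \<kappa> \<epsilon>.
        rational_normal_system.admissible d Q e f V0 u \<kappa> \<and>
        0 \<le> \<epsilon> \<and> \<epsilon> \<le> c_const d * \<tau>\<^sup>2 \<longrightarrow>
        \<not> has_centered_block_decomposition CARD('a) (\<in>)
            (rational_normal_system.points d Q e f V0 u \<kappa>)
            (rational_normal_system.spheres d Q f u \<kappa>) \<tau> \<epsilon>)
     \<and>
     (\<forall>(\<gamma>::'a) m A SS R.
        let P = root_points d \<gamma>; \<Sigma> = discrep CARD('a) root_inc P UNIV in
        m \<ge> 2 \<and> matched_partitions P UNIV m A SS R \<and>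
        (\<forall>i\<in>{1..m}. discrep CARD('a) root_inc (A i) (SS i) \<ge> \<tau> * \<Sigma>) \<and>
        discrep CARD('a) root_inc R UNIV \<le> c_const d * \<tau>\<^sup>2 * \<Sigma> \<longrightarrow>
        cross_discrep CARD('a) root_inc m A SS \<ge> 2 * c_const d * \<tau>\<^sup>2 * \<Sigma>)"
proof (intro conjI allI impI)
  fix \<gamma> :: 'a and \<epsilon> :: real
  assume "0 \<le> \<epsilon> \<and> \<epsilon> \<le> c_const d * \<tau>\<^sup>2"
  thus "\<not> has_centered_block_decomposition CARD('a) root_inc (root_points d \<gamma>) UNIV \<tau> \<epsilon>"
    using no_centered_block_decomposition_root_system[OF assms(1-3,5)] by blast
next
  fix Q :: "'a ^ 'n \<Rightarrow> 'a" and e f V0 u \<kappa> \<epsilon>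
  assume *: "rational_normal_system.admissible d Q e f V0 u \<kappa> \<and> 0 \<le> \<epsilon> \<and> \<epsilon> \<le> c_const d * \<tau>\<^sup>2"
  show "\<not> has_centered_block_decomposition CARD('a) (\<in>)
            (rational_normal_system.points d Q e f V0 u \<kappa>)
            (rational_normal_system.spheres d Q f u \<kappa>) \<tau> \<epsilon>"
    by (rule rational_normal_system.no_centered_block_decomposition_spheres)
      (use * assms two_neq_zero_of_odd_card[where 'a = 'a] in blast)+
next
  fix \<gamma> :: 'a and m A SS R
  show "let P = root_points d \<gamma>; \<Sigma> = discrep CARD('a) root_inc P UNIV in
        m \<ge> 2 \<and> matched_partitions P UNIV m A SS R \<and>
        (\<forall>i\<in>{1..m}. discrep CARD('a) root_inc (A i) (SS i) \<ge> \<tau> * \<Sigma>) \<and>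
        discrep CARD('a) root_inc R UNIV \<le> c_const d * \<tau>\<^sup>2 * \<Sigma> \<longrightarrow>
        cross_discrep CARD('a) root_inc m A SS \<ge> 2 * c_const d * \<tau>\<^sup>2 * \<Sigma>"
    unfolding Let_def using cross_discrep_root_system_ge[OF assms(1-3,5)] by blast
qed

end
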